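(* Let $f$ be an entire function of genus one (in the sense of the context) with $f(0)\neq 0$, all of whose zeros are simple and have positive real part. Suppose that $f$ is in the first order Laguerre-Pólya class ($1$-LP) and is strongly spaced with exponent $\gamma>0$ and spacing constant $C>0$, with zeros $\lambda_1,\lambda_2,\dots$ ordered with increasing real part. If $\lambda_j$ is a zero of $f$ with $\Im(\lambda_j)\neq 0$, $\lambda_{j+1}=\bar{\lambda}_j$, and $j>1$, then $$\left| \Im(\lambda_j) \right| \ge C\,\frac{\sqrt{3}}{2\pi} \left|\Re(\lambda_{\lfloor j/2 \rfloor} )\right|^{\gamma},$$ where $\lfloor j/2\rfloor$ denotes the greatest integer less than or equal to $j/2$. Similarly, if $\Im(\lambda_1)\neq 0$ and $\lambda_2=\bar\lambda_1$ (the case $j=1$), then $$\left| \Im(\lambda_1) \right| \ge C\,\frac{\sqrt{3}}{\pi} \left|\Re(\lambda_1 )\right|^{\gamma}.$$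
   Context: An entire function of genus one with $f(0)\ne 0$ means a function of the form $$f(z) = e^{d_1+d_2z}\prod_{i=1}^{\infty} \left( 1 - \frac{z}{\lambda_i} \right) e^{z/\lambda_i},$$ where $d_1,d_2\in\mathbb{C}$, the $\lambda_i$ are nonzero complex numbers (the zeros of $f$ listed with multiplicity), and $\sum_i \frac{1}{|\lambda_i|^2} <\infty$. The function $f$ is in the first order Laguerre-Pólya class ($1$-LP) if $d_2\in\mathbb{R}$ and $a_1(x):=\sum_i\frac{1}{(\lambda_i-x)^{2}}$ is real and nonnegative for all $x\in\mathbb{R}\setminus\{\lambda_i\}$. (For such $f$ the non-real zeros occur in complex conjugate pairs.) The function $f$ is strongly spaced with exponent $\gamma>0$ and spacing constant $C>0$ if, when the zeros $\lambda_1,\lambda_2,\dots$ are ordered with increasing (i.e. nondecreasing) real part, all real parts being positive, one has $$\Re(\lambda_{j+1}-\lambda_j) \geq C\,| \Re(\lambda_j)|^{\gamma}$$ for all $j$ with $\lambda_{j+1} \ne \bar{\lambda}_j$. *)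

theory Defs
  imports "HOL-Complex_Analysis.Complex_Analysis"
begin

text \<open>
  The factors are indexed from 0 here; their order is immaterial, because the product converges
  absolutely. The factorisation determines \<open>d1\<close> up to a multiple of \<open>2 * pi * \<i>\<close>, \<open>d2\<close> uniquely,
  and \<open>mu\<close> up to a permutation of the indices.
\<close>

definition genus_one_factorization ::
  "(complex \<Rightarrow> complex) \<Rightarrow> complex \<Rightarrow> complex \<Rightarrow> (nat \<Rightarrow> complex) \<Rightarrow> bool" where
  "genus_one_factorization f d1 d2 mu \<longleftrightarrow>
     (\<forall>i. mu i \<noteq> 0) \<and>
     summable (\<lambda>i. 1 / (cmod (mu i))\<^sup>2) \<and>
     (\<forall>z. f z = exp (d1 + d2 * z) * (\<Prod>i. (1 - z / mu i) * exp (z / mu i)))"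

definition genus_one :: "(complex \<Rightarrow> complex) \<Rightarrow> bool" where
  "genus_one f \<longleftrightarrow> (\<exists>d1 d2 mu. genus_one_factorization f d1 d2 mu)"

definition first_order_LP :: "(complex \<Rightarrow> complex) \<Rightarrow> bool" where
  "first_order_LP f \<longleftrightarrow>
     (\<exists>d1 d2 mu. genus_one_factorization f d1 d2 mu \<and> d2 \<in> \<real> \<and>
        (\<forall>x::real. complex_of_real x \<notin> range mu \<longrightarrow>
           (\<Sum>\<^sub>\<infinity>i. 1 / (mu i - complex_of_real x)\<^sup>2) \<in> \<real>\<^sub>\<ge>\<^sub>0))"

text \<open>
  From here on zeros are indexed from 1, and the value of \<open>lam\<close> at 0 is irrelevant. Each zero is
  listed as often as its multiplicity.
\<close>

definition zeros_ordered :: "(complex \<Rightarrow> complex) \<Rightarrow> (nat \<Rightarrow> complex) \<Rightarrow> bool" where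
  "zeros_ordered f lam \<longleftrightarrow>
     (\<forall>i\<ge>1. f (lam i) = 0) \<and>
     (\<forall>z. f z = 0 \<longrightarrow> finite {i. 1 \<le> i \<and> lam i = z} \<and>
                      int (card {i. 1 \<le> i \<and> lam i = z}) = zorder f z) \<and>
     mono_on {1..} (\<lambda>i. Re (lam i))"

text \<open>
  The listing \<open>lam\<close> is an argument because the ordering by real part leaves ties open.
\<close>

definition strongly_spaced ::
  "(complex \<Rightarrow> complex) \<Rightarrow> (nat \<Rightarrow> complex) \<Rightarrow> real \<Rightarrow> real \<Rightarrow> bool" where
  "strongly_spaced f lam \<gamma> C \<longleftrightarrow>
     zeros_ordered f lam \<and>
     (\<forall>j\<ge>1. Re (lam j) > 0) \<and>
     (\<forall>j\<ge>1. lam (j + 1) \<noteq> cnj (lam j) \<longrightarrow>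
        Re (lam (j + 1) - lam j) \<ge> C * \<bar>Re (lam j)\<bar> powr \<gamma>)"

end

theory Submission
  imports Defs
begin

text \<open>
  Evaluate \<open>a\<^sub>1\<close> at \<open>x = Re \<lambda>\<^sub>j\<close>. The pair \<open>\<lambda>\<^sub>j, \<lambda>\<^sub>j\<^sub>+\<^sub>1\<close> contributes \<open>- 2 / (Im \<lambda>\<^sub>j)\<^sup>2\<close>, and every other
  zero contributes a term of real part at most \<open>1 / (Re \<lambda>\<^sub>k - Re \<lambda>\<^sub>j)\<^sup>2\<close>. As at most two consecutive
  zeros share their real part, real parts grow by \<open>D = C |Re \<lambda>\<^sub>k\<^sub>0| powr \<gamma>\<close> within any two steps from
  \<open>k\<^sub>0 = j div 2\<close> (or \<open>k\<^sub>0 = j = 1\<close>) on. So the other zeros contribute at most \<open>2 \<zeta>(2) / D\<^sup>2\<close> on the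
  right and \<open>4 \<zeta>(2) / D\<^sup>2\<close> on the left, and nonnegativity of \<open>a\<^sub>1\<close> bounds \<open>Im \<lambda>\<^sub>j\<close> from below.
\<close>

section \<open>Inverse square sums over spread-out points\<close>

lemma sum_inverse_squares_le:
  "(\<Sum>n<N. 1 / (1 + real n)\<^sup>2) \<le> pi\<^sup>2 / 6"
  using sum_le_suminf[of "\<lambda>n. 1 / (1 + real n)\<^sup>2" "{..<N}"] inverse_squares_sums
  by (simp add: sums_iff add.commute)

text \<open>The summand is constant on each block of \<open>q\<close> consecutive indices. Enlarging
  the range from \<open>N\<close> to \<open>N * q\<close> leaves only whole blocks, and hence
  \<open>q\<close> times a partial sum of \<zeta>(2).\<close>

lemma sum_inverse_squares_blocks_le:
  assumes "q > 0"
  shows "(\<Sum>n<N. 1 / (1 + real (n div q))\<^sup>2) \<le> q * (pi\<^sup>2 / 6)"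
proof -
  have block: "(\<Sum>n<M * q. g (n div q)) = q * (\<Sum>m<M. g m)" for M and g :: "nat \<Rightarrow> real"
  proof -
    have "(\<Sum>n<M * q. g (n div q)) = (\<Sum>m<M. \<Sum>n = m * q..<m * q + q. g (n div q))"
      by (rule sum.nat_group [symmetric])
    also have "\<dots> = (\<Sum>m<M. \<Sum>n = m * q..<m * q + q. g m)"
    proof (intro sum.cong refl)
      fix m n assume "n \<in> {m * q..<m * q + q}"
      then have "n div q = m"
        by (auto intro!: div_nat_eqI simp: algebra_simps)
      then show "g (n div q) = g m" by simp
    qed
    also have "\<dots> = q * (\<Sum>m<M. g m)"
      by (simp add: sum_distrib_left)
    finally show ?thesis .
  qed
  have "(\<Sum>n<N. 1 / (1 + real (n div q))\<^sup>2) \<le> (\<Sum>n<N * q. 1 / (1 + real (n div q))\<^sup>2)"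
    using assms by (intro sum_mono2) auto
  also have "\<dots> = q * (\<Sum>m<N. 1 / (1 + real m)\<^sup>2)"
    by (rule block)
  also have "\<dots> \<le> q * (pi\<^sup>2 / 6)"
    by (intro mult_left_mono sum_inverse_squares_le) auto
  finally show ?thesis .
qed

text \<open>As \<open>h\<close> numbers the points of \<open>F\<close> injectively, each layer
  \<open>h k div q = m\<close> holds at most \<open>q\<close> of them, all at distance at least
  \<open>D * (1 + m)\<close> from 0. The sum is dominated by \<open>q\<close> copies of the series
  for \<zeta>(2), scaled by 1 / D^2.\<close>

lemma sum_inverse_squares_spread_le:
  fixes y :: "'a \<Rightarrow> real" and h :: "'a \<Rightarrow> nat"
  assumes "finite F" and "inj_on h F" and "q > 0" and "D > 0"
    and "\<And>k. k \<in> F \<Longrightarrow> D * (1 + real (h k div q)) \<le> \<bar>y k\<bar>"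
  shows "(\<Sum>k\<in>F. 1 / (y k)\<^sup>2) \<le> q * (pi\<^sup>2 / 6) / D\<^sup>2"
proof -
  let ?g = "\<lambda>n. 1 / (1 + real (n div q))\<^sup>2"
  obtain N where N: "h ` F \<subseteq> {..<N}"
    using assms(1) finite_nat_bounded[of "h ` F"] by auto
  have "(\<Sum>k\<in>F. 1 / (y k)\<^sup>2) \<le> (\<Sum>k\<in>F. ?g (h k) / D\<^sup>2)"
  proof (rule sum_mono)
    fix k assume "k \<in> F"
    from assms(5)[OF this] \<open>D > 0\<close> have "(D * (1 + real (h k div q)))\<^sup>2 \<le> (y k)\<^sup>2"
      by (subst power2_abs [of "y k", symmetric]) (intro power_mono; simp)
    moreover have "D * (1 + real (h k div q)) > 0"
      using \<open>D > 0\<close> by (intro mult_pos_pos) auto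
    ultimately have "1 / (y k)\<^sup>2 \<le> 1 / (D * (1 + real (h k div q)))\<^sup>2"
      by (intro frac_le zero_less_power) auto
    then show "1 / (y k)\<^sup>2 \<le> ?g (h k) / D\<^sup>2"
      by (simp add: power_mult_distrib mult.commute)
  qed
  also have "\<dots> = (\<Sum>n\<in>h ` F. ?g n) / D\<^sup>2"
    using assms(2) by (simp add: sum.reindex sum_divide_distrib)
  also have "\<dots> \<le> (\<Sum>n<N. ?g n) / D\<^sup>2"
    using N by (intro divide_right_mono sum_mono2) auto
  also have "\<dots> \<le> q * (pi\<^sup>2 / 6) / D\<^sup>2"
    using assms(3) by (intro divide_right_mono sum_inverse_squares_blocks_le) auto
  finally show ?thesis .
qed

text \<open>Induction in steps of two; a leftover single step for odd \<open>n\<close> costs nothing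
  by monotonicity.\<close>

lemma two_step_growth:
  fixes x :: "nat \<Rightarrow> real"
  assumes "\<And>k. k0 \<le> k \<Longrightarrow> x k + D \<le> x (k + 2)"
    and "\<And>k. k0 \<le> k \<Longrightarrow> x k \<le> x (Suc k)"
    and "k0 \<le> i"
  shows "x i + D * real (n div 2) \<le> x (i + n)"
proof (induction n rule: less_induct)
  case (less n)
  consider "n = 0" | "n = 1" | m where "n = m + 2"
    by (metis One_nat_def add_2_eq_Suc' not0_implies_Suc)
  then show ?case
  proof cases
    case 3
    then show ?thesis
      using less[of m] assms(1)[of "i + m"] assms(3) by (simp add: algebra_simps)
  qed (use assms in auto)
qed

text \<open>Bounding by the modulus discards \<open>Im w\<close>, so that the remaining zeros need
  to be controlled only through their real parts.\<close>

lemma Re_inverse_square_le: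
  assumes "Re w \<noteq> 0"
  shows "Re (1 / w\<^sup>2) \<le> 1 / (Re w)\<^sup>2"
proof -
  have "Re (1 / w\<^sup>2) \<le> cmod (1 / w\<^sup>2)"
    by (rule complex_Re_le_cmod)
  also have "\<dots> = 1 / ((Re w)\<^sup>2 + (Im w)\<^sup>2)"
    by (simp add: norm_divide norm_power cmod_power2)
  also have "\<dots> \<le> 1 / (Re w)\<^sup>2"
    using assms by (intro divide_left_mono) (auto intro!: mult_pos_pos add_pos_nonneg)
  finally show ?thesis .
qed

section \<open>Zeros of functions of genus one\<close>

lemma summable_inverse_square_imp_filterlim:
  fixes mu :: "nat \<Rightarrow> complex"
  assumes "\<And>i. mu i \<noteq> 0" and "summable (\<lambda>i. 1 / (cmod (mu i))\<^sup>2)"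
  shows "filterlim mu at_infinity sequentially"
proof -
  have "(\<lambda>i. sqrt (1 / (cmod (mu i))\<^sup>2)) \<longlonglongrightarrow> sqrt 0"
    by (intro tendsto_real_sqrt summable_LIMSEQ_zero assms(2))
  then have "(\<lambda>i. norm (inverse (mu i))) \<longlonglongrightarrow> 0"
    by (simp add: real_sqrt_divide norm_divide inverse_eq_divide)
  then have "(\<lambda>i. inverse (mu i)) \<longlonglongrightarrow> 0"
    by (rule tendsto_norm_zero_cancel)
  then have "filterlim (\<lambda>i. inverse (mu i)) (at 0) sequentially"
    using assms(1) by (simp add: filterlim_at)
  then show ?thesis
    by (subst filterlim_inverse_at_iff [symmetric])
qed

text \<open>The infinite product is a Weierstrass product with elementary factors of degree 1, whose
  zeros and multiplicities are known; the exponential in front has no zeros and so leaves orders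
  unchanged.\<close>

lemma genus_one_factorization_zeros:
  assumes "genus_one_factorization f d1 d2 mu"
  shows "f z = 0 \<longleftrightarrow> z \<in> range mu"
    and "zorder f z = card (mu -` {z})"
proof -
  have nz: "\<And>i. mu i \<noteq> 0" and sm: "summable (\<lambda>i. 1 / (cmod (mu i))\<^sup>2)"
    and fac: "\<And>z. f z = exp (d1 + d2 * z) * (\<Prod>i. (1 - z / mu i) * exp (z / mu i))"
    using assms by (auto simp: genus_one_factorization_def)
  interpret W: weierstrass_product mu "\<lambda>_. Suc 0"
  proof
    fix r :: real
    \<comment> \<open>Degree 1 calls for exponent 2, so this is r^2 times the given series.\<close>
    show "summable (\<lambda>n. (r / cmod (mu n)) ^ Suc (Suc 0))"
      using summable_mult[OF sm, of "r\<^sup>2"]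
      by (simp add: power_divide flip: power2_eq_square)
  qed (use nz summable_inverse_square_imp_filterlim[OF nz sm] in auto)
  have f_eq: "f = (\<lambda>z. exp (d1 + d2 * z) * W.f z)"
    by (rule ext) (unfold fac W.f_def weierstrass_factor_def, simp)
  show "f z = 0 \<longleftrightarrow> z \<in> range mu"
    by (simp add: f_eq W.zero)
  \<comment> \<open>The zeros of \<open>W.f\<close> are isolated, so the order of the product is the
    sum of the orders.\<close>
  have "eventually (\<lambda>w. W.f w \<noteq> 0) (at z)"
    using W.not_islimpt_range_a[of z] by (auto simp: islimpt_iff_eventually W.zero)
  then have "zorder f z = zorder (\<lambda>z. exp (d1 + d2 * z)) z + zorder W.f z"
    unfolding f_eq
    by (intro zorder_times_analytic) (auto intro!: analytic_intros W.analytic)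
  also have "zorder (\<lambda>z. exp (d1 + d2 * z)) z = 0"
    by (intro zorder_eq_0I) (auto intro!: analytic_intros)
  finally show "zorder f z = card (mu -` {z})"
    by (simp add: W.zorder)
qed

text \<open>Eventually \<open>cmod (mu i)\<close> is at least \<open>2 * cmod z\<close>, and then
  the term is at most 4 times the unshifted one. The unordered form of convergence is what permits
  reindexing the sum.\<close>

lemma summable_on_inverse_square_shift:
  fixes mu :: "nat \<Rightarrow> complex"
  assumes "\<And>i. mu i \<noteq> 0" and "summable (\<lambda>i. 1 / (cmod (mu i))\<^sup>2)"
  shows "(\<lambda>i. 1 / (mu i - z)\<^sup>2) summable_on UNIV"
proof (rule norm_summable_imp_summable_on, rule summable_comparison_test_ev)
  have "eventually (\<lambda>i. cmod (mu i) \<ge> 2 * cmod z) sequentially"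
    using summable_inverse_square_imp_filterlim[OF assms]
    by (metis filterlim_at_infinity_imp_norm_at_top filterlim_at_top)
  then show "eventually (\<lambda>i. norm (norm (1 / (mu i - z)\<^sup>2)) \<le> 4 * (1 / (cmod (mu i))\<^sup>2)) sequentially"
  proof eventually_elim
    case (elim i)
    have "0 < cmod (mu i) / 2"
      using assms(1) by simp
    moreover have "cmod (mu i) / 2 \<le> cmod (mu i - z)"
      using elim norm_triangle_ineq2[of "mu i" z] by linarith
    ultimately have "1 / (cmod (mu i - z))\<^sup>2 \<le> 1 / (cmod (mu i) / 2)\<^sup>2"
      by (intro divide_left_mono power_mono mult_pos_pos zero_less_power) auto
    then show ?case
      by (simp add: norm_divide norm_power power_divide)
  qed
qed (intro summable_mult assms)

section \<open>The Laguerre-P\<hungarumlaut>olya condition along an ordered listing of simple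
  zeros\<close>

lemma zeros_ordered_simple_bij_betw:
  assumes "zeros_ordered f lam" and "\<And>z. f z = 0 \<Longrightarrow> zorder f z = 1"
  shows "bij_betw lam {1..} {z. f z = 0}"
proof -
  have one: "card {i. 1 \<le> i \<and> lam i = z} = 1" if "f z = 0" for z
    using assms that by (auto simp: zeros_ordered_def)
  have "i = k" if "i \<ge> 1" "k \<ge> 1" "lam i = lam k" for i k
  proof -
    have "f (lam k) = 0"
      using assms(1) that by (auto simp: zeros_ordered_def)
    then obtain m where "{i. 1 \<le> i \<and> lam i = lam k} = {m}"
      using one card_1_singletonE by blast
    moreover have "i \<in> {i. 1 \<le> i \<and> lam i = lam k}" "k \<in> {i. 1 \<le> i \<and> lam i = lam k}"
      using that by auto
    ultimately show ?thesis
      by simp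
  qed
  then have "inj_on lam {1..}"
    by (auto intro!: inj_onI)
  moreover have "lam ` {1..} = {z. f z = 0}"
  proof (intro equalityI subsetI)
    fix z assume "z \<in> {z. f z = 0}"
    then obtain m where "{i. 1 \<le> i \<and> lam i = z} = {m}"
      using one card_1_singletonE by blast
    then show "z \<in> lam ` {1..}" by force
  qed (use assms(1) in \<open>auto simp: zeros_ordered_def\<close>)
  ultimately show ?thesis
    by (simp add: bij_betw_def)
qed

lemma genus_one_factorization_simple_bij_betw:
  assumes "genus_one_factorization f d1 d2 mu" and "\<And>z. f z = 0 \<Longrightarrow> zorder f z = 1"
  shows "bij_betw mu UNIV {z. f z = 0}"
proof -
  note Z = genus_one_factorization_zeros[OF assms(1)]
  have "i = k" if "mu i = mu k" for i k
  proof -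
    have "card (mu -` {mu k}) = 1"
      using Z(1,2)[of "mu k"] assms(2)[of "mu k"] by simp
    then obtain m where "mu -` {mu k} = {m}"
      using card_1_singletonE by blast
    moreover have "i \<in> mu -` {mu k}" "k \<in> mu -` {mu k}"
      using that by auto
    ultimately show ?thesis
      by simp
  qed
  then show ?thesis
    using Z(1) by (auto simp: bij_betw_def inj_def)
qed

text \<open>The family \<open>mu\<close> for which \<open>first_order_LP\<close> asserts
  nonnegativity is unrelated in order to \<open>lam\<close>. Since the zeros are simple, both biject
  onto the zero set, and the unordered sum carries over from one to the other.\<close>

lemma first_order_LP_ordered:
  assumes "first_order_LP f" and "zeros_ordered f lam"
    and simple: "\<And>z. f z = 0 \<Longrightarrow> zorder f z = 1"
    and "f (complex_of_real x) \<noteq> 0"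
  shows "(\<lambda>k. Re (1 / (lam k - complex_of_real x)\<^sup>2)) summable_on {1..}"
    and "0 \<le> (\<Sum>\<^sub>\<infinity>k\<in>{1..}. Re (1 / (lam k - complex_of_real x)\<^sup>2))"
proof -
  let ?h = "\<lambda>z. 1 / (z - complex_of_real x)\<^sup>2"
  obtain d1 d2 mu where fac: "genus_one_factorization f d1 d2 mu"
    and LP: "complex_of_real x \<notin> range mu \<Longrightarrow> (\<Sum>\<^sub>\<infinity>i. ?h (mu i)) \<in> \<real>\<^sub>\<ge>\<^sub>0"
    using assms(1) by (auto simp: first_order_LP_def)
  have bij: "bij_betw mu UNIV {z. f z = 0}" "bij_betw lam {1..} {z. f z = 0}"
    using genus_one_factorization_simple_bij_betw[OF fac simple]
      zeros_ordered_simple_bij_betw[OF assms(2) simple] by auto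
  have "(\<lambda>i. ?h (mu i)) summable_on UNIV"
    using fac by (intro summable_on_inverse_square_shift) (auto simp: genus_one_factorization_def)
  then have sm: "(\<lambda>k. ?h (lam k)) summable_on {1..}"
    using summable_on_reindex_bij_betw[OF bij(1), of ?h]
      summable_on_reindex_bij_betw[OF bij(2), of ?h] by simp
  then show "(\<lambda>k. Re (?h (lam k))) summable_on {1..}"
    by (rule summable_on_Re)
  have "(\<Sum>\<^sub>\<infinity>k\<in>{1..}. ?h (lam k)) = (\<Sum>\<^sub>\<infinity>i. ?h (mu i))"
    using infsum_reindex_bij_betw[OF bij(1), of ?h]
      infsum_reindex_bij_betw[OF bij(2), of ?h] by simp
  moreover have "complex_of_real x \<notin> range mu"
    using assms(4) genus_one_factorization_zeros(1)[OF fac] by simp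
  ultimately have "(\<Sum>\<^sub>\<infinity>k\<in>{1..}. ?h (lam k)) \<in> \<real>\<^sub>\<ge>\<^sub>0"
    using LP by simp
  then have "0 \<le> Re (\<Sum>\<^sub>\<infinity>k\<in>{1..}. ?h (lam k))"
    by (simp add: complex_nonneg_Reals_iff)
  then show "0 \<le> (\<Sum>\<^sub>\<infinity>k\<in>{1..}. Re (?h (lam k)))"
    by (simp only: infsum_Re[OF sm])
qed

text \<open>In the nonnegative sum at \<open>x = Re (lam j)\<close>, the conjugate pair contributes
  \<open>- 2 / (Im (lam j))\<^sup>2\<close>, which the other terms, bounded in total by
  \<open>B\<close>, have to compensate.\<close>

lemma first_order_LP_conjugate_pair:
  assumes "first_order_LP f" and "zeros_ordered f lam"
    and "\<And>z. f z = 0 \<Longrightarrow> zorder f z = 1"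
    and "j \<ge> 1" and "Im (lam j) \<noteq> 0" and "lam (j + 1) = cnj (lam j)"
    and ne: "\<And>k. k \<ge> 1 \<Longrightarrow> k \<noteq> j \<Longrightarrow> k \<noteq> j + 1 \<Longrightarrow> Re (lam k) \<noteq> Re (lam j)"
    and B: "\<And>F. finite F \<Longrightarrow> F \<subseteq> {1..} - {j, j + 1} \<Longrightarrow>
              (\<Sum>k\<in>F. 1 / (Re (lam k) - Re (lam j))\<^sup>2) \<le> B"
  shows "2 / (Im (lam j))\<^sup>2 \<le> B"
proof -
  let ?x = "complex_of_real (Re (lam j))"
  let ?g = "\<lambda>k. Re (1 / (lam k - ?x)\<^sup>2)"
  have "f ?x \<noteq> 0"
  \<comment> \<open>A zero at this real point would be some \<open>lam k\<close>; \<open>ne\<close>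
    leaves only the pair itself, which is not real.\<close>
  proof
    assume "f ?x = 0"
    moreover have "lam ` {1..} = {z. f z = 0}"
      using zeros_ordered_simple_bij_betw[OF assms(2,3)] by (simp add: bij_betw_def)
    ultimately obtain k where "k \<ge> 1" "lam k = ?x"
      by (metis (mono_tags, lifting) atLeast_iff imageE mem_Collect_eq)
    then show False
      using ne[of k] assms(5,6) by (cases "k = j \<or> k = j + 1") (auto simp: complex_eq_iff)
  qed
  note LP = first_order_LP_ordered[OF assms(1-3) this]
  have rest: "?g summable_on {1..} - {j, j + 1}"
    by (rule summable_on_subset_banach[OF LP(1)]) auto
  have "infsum ?g ({1..} - {j, j + 1}) \<le> B"
  proof (rule infsum_le_finite_sums[OF rest])
    fix F assume F: "finite F" "F \<subseteq> {1..} - {j, j + 1}"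
    have "sum ?g F \<le> (\<Sum>k\<in>F. 1 / (Re (lam k) - Re (lam j))\<^sup>2)"
    proof (rule sum_mono)
      fix k assume "k \<in> F"
      then show "?g k \<le> 1 / (Re (lam k) - Re (lam j))\<^sup>2"
        using Re_inverse_square_le[of "lam k - ?x"] ne[of k] F(2) by force
    qed
    also have "\<dots> \<le> B"
      by (rule B[OF F])
    finally show "sum ?g F \<le> B" .
  qed
  moreover have "infsum ?g {1..} = infsum ?g {j, j + 1} + infsum ?g ({1..} - {j, j + 1})"
    using infsum_Un_disjoint[of ?g "{j, j + 1}" "{1..} - {j, j + 1}"] rest \<open>j \<ge> 1\<close>
    by (simp add: insert_absorb)
  moreover have "infsum ?g {j, j + 1} = - (2 / (Im (lam j))\<^sup>2)"
  proof -
    have "lam j - ?x = \<i> * Im (lam j)" "lam (j + 1) - ?x = - (\<i> * Im (lam j))"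
      using assms(6) by (auto simp: complex_eq_iff)
    then show ?thesis
      by (simp add: power_mult_distrib flip: of_real_power)
  qed
  ultimately show ?thesis
    using LP(2) by linarith
qed

section \<open>Consequences of strong spacing for the real parts\<close>

lemma strongly_spaced_two_step:
  assumes "strongly_spaced f lam \<gamma> C" and "inj_on lam {1..}" and "k \<ge> 1"
  shows "Re (lam k) + C * \<bar>Re (lam k)\<bar> powr \<gamma> \<le> Re (lam (k + 2))"
proof -
  have gap: "Re (lam i) + C * \<bar>Re (lam i)\<bar> powr \<gamma> \<le> Re (lam (i + 1))"
    if "i \<ge> 1" "lam (i + 1) \<noteq> cnj (lam i)" for i
    using assms(1) that by (force simp: strongly_spaced_def)
  have mono: "Re (lam i) \<le> Re (lam (i + 1))" if "i \<ge> 1" for i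
    using assms(1) that by (auto simp: strongly_spaced_def zeros_ordered_def mono_on_def)
  show ?thesis
  \<comment> \<open>Two successive steps cannot both be conjugations, as this would give
    \<open>lam (k + 2) = lam k\<close>. So at least one of the two steps has the full gap, and a
    conjugation step does not change the real part.\<close>
  proof (cases "lam (k + 1) = cnj (lam k)")
    case True
    have "lam (k + 2) \<noteq> lam k"
      using assms(2,3) by (auto dest: inj_onD)
    then have "lam (k + 1 + 1) \<noteq> cnj (lam (k + 1))"
      using True by simp
    then show ?thesis
      using gap[of "k + 1"] True by simp
  next
    case False
    then show ?thesis
      using gap[of k] mono[of "k + 1"] assms(3) by simp
  qed
qed

text \<open>Numbering starts at \<open>j + 2\<close>, which already lies \<open>D\<close> beyond
  \<open>x j\<close>; every two further indices add another \<open>D\<close>, so layers hold two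
  points each.\<close>

lemma sum_inverse_squares_right_le:
  fixes x :: "nat \<Rightarrow> real"
  assumes "\<And>k. k0 \<le> k \<Longrightarrow> x k + D \<le> x (k + 2)"
    and "\<And>k. k0 \<le> k \<Longrightarrow> x k \<le> x (Suc k)"
    and "k0 \<le> j" and "D > 0" and "finite F" and "F \<subseteq> {j + 2..}"
  shows "(\<Sum>k\<in>F. 1 / (x k - x j)\<^sup>2) \<le> 2 * (pi\<^sup>2 / 6) / D\<^sup>2"
proof -
  have "D * (1 + real ((k - (j + 2)) div 2)) \<le> \<bar>x k - x j\<bar>" if "k \<in> F" for k
  proof -
    define n where "n = k - (j + 2)"
    have "k = j + (n + 2)"
      using that assms(6) by (auto simp: n_def)
    then have "x j + D * real ((n + 2) div 2) \<le> x k"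
      using two_step_growth[OF assms(1-3), of "n + 2"] by simp
    then show ?thesis
      unfolding n_def [symmetric] by simp
  qed
  moreover have "inj_on (\<lambda>k. k - (j + 2)) F"
    using assms(6) by (intro inj_on_diff_nat) auto
  ultimately show ?thesis
    using sum_inverse_squares_spread_le[of F "\<lambda>k. k - (j + 2)" 2 D "\<lambda>k. x k - x j"] assms(4,5)
    by simp
qed

text \<open>
  The two-step gap \<open>D\<close> is only available from the index \<open>j div 2\<close> on. The earlier points are at
  least as far from \<open>x j\<close> as \<open>x (j div 2)\<close>, which still yields a gap \<open>D\<close> per four indices.
\<close>

lemma sum_inverse_squares_left_le:
  fixes x :: "nat \<Rightarrow> real"
  assumes "\<And>k. j div 2 \<le> k \<Longrightarrow> x k + D \<le> x (k + 2)"
    and mono: "mono_on {1..} x"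
    and "x (j - 1) + D \<le> x j"
    and "j > 1" and "D > 0" and "F \<subseteq> {1..<j}"
  shows "(\<Sum>k\<in>F. 1 / (x k - x j)\<^sup>2) \<le> 4 * (pi\<^sup>2 / 6) / D\<^sup>2"
proof -
  have "D * (1 + real ((j - 1 - k) div 4)) \<le> \<bar>x k - x j\<bar>" if "k \<in> F" for k
  proof -
    define i where "i = max k (j div 2)"
    have k: "1 \<le> k" "k < j"
      using that assms(6) by auto
    have i: "j div 2 \<le> i" "1 \<le> i" "k \<le> i" "i \<le> j - 1"
      using k by (auto simp: i_def)
    have "x k \<le> x i"
      using mono k i by (auto simp: mono_on_def)
    moreover have "x i + D * real ((j - 1 - i) div 2) \<le> x (j - 1)"
    proof -
      have "x m \<le> x (Suc m)" if "j div 2 \<le> m" for m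
        using mono that \<open>j > 1\<close> by (auto simp: mono_on_def)
      from two_step_growth[OF assms(1) this i(1), of "j - 1 - i"] show ?thesis
        by (simp only: le_add_diff_inverse[OF i(4)])
    qed
    \<comment> \<open>For \<open>k\<close> below \<open>j div 2\<close> one has
      \<open>i = j div 2\<close>, and \<open>k \<ge> 1\<close> gives
      \<open>j - 1 - k \<le> j - 2\<close>, about twice \<open>j - 1 - i\<close> at most. Otherwise
      \<open>i = k\<close>.\<close>
    moreover have "(j - 1 - k) div 4 \<le> (j - 1 - i) div 2"
      unfolding i_def using k by linarith
    then have "D * real ((j - 1 - k) div 4) \<le> D * real ((j - 1 - i) div 2)"
      using \<open>D > 0\<close> by (intro mult_left_mono) auto
    \<comment> \<open>The gap between \<open>j - 1\<close> and \<open>j\<close> supplies the summand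
      1.\<close>
    ultimately show ?thesis
      unfolding distrib_left using assms(3) by linarith
  qed
  moreover have "inj_on (\<lambda>k. j - 1 - k) F"
    by (rule inj_on_subset[OF _ assms(6)]) (auto simp: inj_on_def)
  moreover have "finite F"
    using assms(6) finite_subset by blast
  ultimately show ?thesis
    using sum_inverse_squares_spread_le[of F "\<lambda>k. j - 1 - k" 4 D "\<lambda>k. x k - x j"] assms(5)
    by simp
qed

text \<open>The factor 6 is 2 from the right plus 4 from the left; for \<open>j = 1\<close> nothing
  lies on the left, leaving 2. The 12 comes from clearing denominators in 2 / Im^2 \<le> q (\<pi>^2
  / 6) / D^2, where q is that factor.\<close>

lemma strongly_spaced_conjugate_pair:
  assumes "first_order_LP f" and spaced: "strongly_spaced f lam \<gamma> C"
    and simple: "\<And>z. f z = 0 \<Longrightarrow> zorder f z = 1"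
    and "\<gamma> > 0" and "C > 0"
    and j: "j \<ge> 1" "Im (lam j) \<noteq> 0" "lam (j + 1) = cnj (lam j)"
    and k0: "k0 = (if j = 1 then 1 else j div 2)"
  shows "12 * (C * \<bar>Re (lam k0)\<bar> powr \<gamma>)\<^sup>2 \<le> (if j = 1 then 2 else 6) * (pi * Im (lam j))\<^sup>2"
proof -
  define x where "x k = Re (lam k)" for k
  define D where "D = C * \<bar>x k0\<bar> powr \<gamma>"
  have pos: "x k > 0" if "k \<ge> 1" for k
    using spaced that by (auto simp: strongly_spaced_def x_def)
  have ordered: "zeros_ordered f lam"
    using spaced by (simp add: strongly_spaced_def)
  have mono: "mono_on {1..} x"
    using ordered by (simp add: zeros_ordered_def x_def [abs_def])
  have inj: "inj_on lam {1..}"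
    using zeros_ordered_simple_bij_betw[OF ordered simple] by (simp add: bij_betw_def)
  have k0': "1 \<le> k0" "k0 \<le> j" "j > 1 \<Longrightarrow> k0 \<le> j - 1"
    using k0 j(1) by auto
  have "D > 0"
    unfolding D_def using pos[OF k0'(1)] \<open>C > 0\<close> by (intro mult_pos_pos) auto
  \<comment> \<open>The required gap grows with the real part, so its value at \<open>k0\<close>
    serves for all later indices.\<close>
  have D_le: "D \<le> C * \<bar>x k\<bar> powr \<gamma>" if "k0 \<le> k" for k
  proof -
    have "0 < x k0" "x k0 \<le> x k"
      using that k0'(1) mono pos[OF k0'(1)] by (auto simp: mono_on_def)
    then show ?thesis
      unfolding D_def using \<open>C > 0\<close> \<open>\<gamma> > 0\<close> by (intro mult_left_mono powr_mono2) auto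
  qed
  have two_step: "x k + D \<le> x (k + 2)" if "k0 \<le> k" for k
    using strongly_spaced_two_step[OF spaced inj, of k] D_le[OF that] that k0'(1)
    by (simp add: x_def)
  have step: "x k \<le> x (Suc k)" if "k0 \<le> k" for k
    using mono that k0'(1) by (auto simp: mono_on_def)
  \<comment> \<open>The conjugate of \<open>lam j\<close> is \<open>lam (j + 1)\<close>, hence not
    \<open>lam (j - 1)\<close>, and the step into \<open>j\<close> has a full gap.\<close>
  have before: "x (j - 1) + D \<le> x j" if "j > 1"
  proof -
    have "lam (j + 1) \<noteq> lam (j - 1)"
      using inj that by (auto dest: inj_onD)
    then have "lam (j - 1 + 1) \<noteq> cnj (lam (j - 1))"
      using that j(3) by auto
    moreover have "1 \<le> j - 1"
      using that by simp
    ultimately have "Re (lam (j - 1 + 1) - lam (j - 1)) \<ge> C * \<bar>Re (lam (j - 1))\<bar> powr \<gamma>"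
      using spaced unfolding strongly_spaced_def by blast
    then show ?thesis
      using D_le[OF k0'(3)[OF that]] that by (simp add: x_def)
  qed
  let ?q = "if j = 1 then 2 else 6 :: real"
  have "2 / (Im (lam j))\<^sup>2 \<le> ?q * (pi\<^sup>2 / 6) / D\<^sup>2"
  proof (rule first_order_LP_conjugate_pair[OF assms(1) ordered simple j])
    fix k assume k: "k \<ge> 1" "k \<noteq> j" "k \<noteq> j + 1"
    then consider "j > 1" "k \<le> j - 1" | "j + 2 \<le> k"
      by linarith
    then show "Re (lam k) \<noteq> Re (lam j)"
    proof cases
      case 1
      then have "x k \<le> x (j - 1)"
        using mono k by (auto simp: mono_on_def)
      then show ?thesis
        using before[OF 1(1)] \<open>D > 0\<close> by (simp add: x_def)
    next
      case 2
      then have "x (j + 2) \<le> x k"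
        using mono by (auto simp: mono_on_def)
      then show ?thesis
        using two_step[OF k0'(2)] \<open>D > 0\<close> by (simp add: x_def)
    qed
  next
    fix F :: "nat set" assume F: "finite F" "F \<subseteq> {1..} - {j, j + 1}"
    let ?S = "\<lambda>A. \<Sum>k\<in>A. 1 / (x k - x j)\<^sup>2"
    have "?S F = ?S (F \<inter> {1..<j}) + ?S (F \<inter> {j + 2..})"
    proof -
      have "F = (F \<inter> {1..<j}) \<union> (F \<inter> {j + 2..})"
        using F(2) by fastforce
      then show ?thesis
        using F(1) by (subst sum.union_disjoint [symmetric]) auto
    qed
    moreover have "?S (F \<inter> {j + 2..}) \<le> 2 * (pi\<^sup>2 / 6) / D\<^sup>2"
      by (rule sum_inverse_squares_right_le[OF two_step step k0'(2) \<open>D > 0\<close>]) (use F in auto)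
    moreover have "?S (F \<inter> {1..<j}) \<le> (if j = 1 then 0 else 4) * (pi\<^sup>2 / 6) / D\<^sup>2"
    proof (cases "j = 1")
      case False
      then have "j > 1" "j div 2 = k0"
        using j(1) k0 by auto
      then have "?S (F \<inter> {1..<j}) \<le> 4 * (pi\<^sup>2 / 6) / D\<^sup>2"
        by (intro sum_inverse_squares_left_le two_step mono before \<open>D > 0\<close>) auto
      then show ?thesis
        using False by simp
    qed simp
    moreover have "(if j = 1 then 0 else 4) * (pi\<^sup>2 / 6) / D\<^sup>2 + 2 * (pi\<^sup>2 / 6) / D\<^sup>2
        = ?q * (pi\<^sup>2 / 6) / D\<^sup>2"
      by (simp flip: add_divide_distrib)
    ultimately show "(\<Sum>k\<in>F. 1 / (Re (lam k) - Re (lam j))\<^sup>2) \<le> ?q * (pi\<^sup>2 / 6) / D\<^sup>2"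
      unfolding x_def by linarith
  qed
  then have "12 * D\<^sup>2 \<le> ?q * (pi * Im (lam j))\<^sup>2"
    using \<open>D > 0\<close> j(2) by (simp add: field_simps power_mult_distrib)
  then show ?thesis
    by (simp add: D_def x_def)
qed

theorem theorem5p1:
  fixes f :: "complex \<Rightarrow> complex" and lam :: "nat \<Rightarrow> complex" and \<gamma> C :: real
  assumes "genus_one f" and "f 0 \<noteq> 0"
    and "\<And>z. f z = 0 \<Longrightarrow> zorder f z = 1"
    and "\<And>z. f z = 0 \<Longrightarrow> Re z > 0"
    and "first_order_LP f"
    and "\<gamma> > 0" and "C > 0"
    and "strongly_spaced f lam \<gamma> C"
  shows "(\<forall>j>1. Im (lam j) \<noteq> 0 \<and> lam (j + 1) = cnj (lam j) \<longrightarrow>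
           \<bar>Im (lam j)\<bar> \<ge> C * (sqrt 3 / (2 * pi)) * \<bar>Re (lam (j div 2))\<bar> powr \<gamma>) \<and>
         (Im (lam 1) \<noteq> 0 \<and> lam 2 = cnj (lam 1) \<longrightarrow>
           \<bar>Im (lam 1)\<bar> \<ge> C * (sqrt 3 / pi) * \<bar>Re (lam 1)\<bar> powr \<gamma>)"
proof (intro conjI allI impI)
  \<comment> \<open>Square roots are taken once for both claims, with \<open>c = 2\<close> for
    \<open>j > 1\<close> and \<open>c = 1\<close> for \<open>j = 1\<close>.\<close>
  have bound: "D * (sqrt 3 / (c * pi)) \<le> \<bar>b\<bar>"
    if "3 * D\<^sup>2 \<le> c\<^sup>2 * (pi * b)\<^sup>2" "c > 0" for D b c :: real
  proof -
    have "sqrt 3 * D \<le> \<bar>c * (pi * b)\<bar>"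
      by (rule power2_le_imp_le) (use that in \<open>auto simp: power_mult_distrib\<close>)
    then show ?thesis
      using \<open>c > 0\<close> by (simp add: abs_mult field_simps)
  qed
  note pair = strongly_spaced_conjugate_pair[OF assms(5,8,3,6,7)]
  {
    fix j :: nat assume "j > 1" "Im (lam j) \<noteq> 0 \<and> lam (j + 1) = cnj (lam j)"
    then have "12 * (C * \<bar>Re (lam (j div 2))\<bar> powr \<gamma>)\<^sup>2 \<le> 6 * (pi * Im (lam j))\<^sup>2"
      using pair[of j "j div 2"] by simp
    \<comment> \<open>The estimate gives the factor 3/2 here, which is relaxed to 4 = 2^2 to match
      the stated constant.\<close>
    then have "3 * (C * \<bar>Re (lam (j div 2))\<bar> powr \<gamma>)\<^sup>2 \<le> 4 * (pi * Im (lam j))\<^sup>2"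
      using zero_le_power2[of "pi * Im (lam j)"] by linarith
    with bound[of "C * \<bar>Re (lam (j div 2))\<bar> powr \<gamma>" 2 "Im (lam j)"]
    show "\<bar>Im (lam j)\<bar> \<ge> C * (sqrt 3 / (2 * pi)) * \<bar>Re (lam (j div 2))\<bar> powr \<gamma>"
      by (simp add: mult_ac)
  next
    assume "Im (lam 1) \<noteq> 0 \<and> lam 2 = cnj (lam 1)"
    then have "12 * (C * \<bar>Re (lam 1)\<bar> powr \<gamma>)\<^sup>2 \<le> 2 * (pi * Im (lam 1))\<^sup>2"
      using pair[of 1 1] by (simp add: numeral_2_eq_2)
    then have "3 * (C * \<bar>Re (lam 1)\<bar> powr \<gamma>)\<^sup>2 \<le> (pi * Im (lam 1))\<^sup>2"
      using zero_le_power2[of "C * \<bar>Re (lam 1)\<bar> powr \<gamma>"] by linarith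
    with bound[of "C * \<bar>Re (lam 1)\<bar> powr \<gamma>" 1 "Im (lam 1)"]
    show "\<bar>Im (lam 1)\<bar> \<ge> C * (sqrt 3 / pi) * \<bar>Re (lam 1)\<bar> powr \<gamma>"
      by (simp add: mult_ac)
  }
qed

end
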